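(* Let $R$ be an integral domain of characteristic $0$, $k\ge1$, and $S=H_R^k[[\mathbf{x}]]$. Then $(\mathfrak{A}_S(\mathbf{x}),\boxplus,\odot)$, where $\mathfrak{A}_S(\mathbf{x})=\{\mathfrak{A}_\phi(\mathbf{x}):\phi\in S\}$, is a commutative ring with additive unit $\mathbf{0}_{\mathfrak{A}}=(\mathbf{x},0,0,\dots)$ and multiplicative unit $\mathbf{1}_{\mathfrak{A}}=(\mathbf{x},\mathbf{1},0,0,\dots)$.
   Context: $\mathbb{N}=\{0,1,2,\dots\}$. $H_R[[\mathbf{x}]]$ is the ring of formal series $\sum_{\mathbf n\in\mathbb{N}^k}a_{\mathbf n}\frac{x_1^{n_1}\cdots x_k^{n_k}}{n_1!\cdots n_k!}$ with $a_{\mathbf n}\in R$, with usual addition and multiplication of power series, and $\partial_l=\partial/\partial x_l$. $S=H_R^k[[\mathbf{x}]]$ is the direct product of $k$ copies, with componentwise sum and product $\cdot$; $\mathbf 1=(1,\dots,1)$, and $\mathbf{x}$ as an element of $S$ means $(x_1,\dots,x_k)$. For $\phi,F\in S$, $\mathfrak{D}_\phi(F)=\frac{\partial F}{\partial\mathbf{x}}\phi^\top$ has $i$-th component $\sum_{l=1}^k\partial_l(f_i)\phi_l$; $\mathfrak{D}_\phi^0(F)=F$, $\mathfrak{D}_\phi^{n+1}(F)=\mathfrak{D}_\phi(\mathfrak{D}_\phi^n(F))$; $\mathfrak{A}_\phi(F)=(\mathfrak{D}_\phi^n(F))_{n\in\mathbb{N}}$. $\mathfrak{A}_\phi(\mathbf{x})\boxplus\mathfrak{A}_\psi(\mathbf{x})=(B_n)_{n\in\mathbb{N}}$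 with $B_0=\mathbf{x}$, $B_1=\mathfrak{D}_\phi(\mathbf{x})+\mathfrak{D}_\psi(\mathbf{x})$, $B_n=\mathfrak{D}^n_\phi(\mathbf{x})+\mathfrak{D}^n_\psi(\mathbf{x})+H_n(\phi,\psi)$ for $n\ge2$, where $H_1(\phi,\psi)=0$ and $H_{n+1}(\phi,\psi)=\mathfrak{D}_\phi(\mathfrak{D}_\psi^n(\mathbf{x}))+\mathfrak{D}_\psi(\mathfrak{D}_\phi^n(\mathbf{x}))+\mathfrak{D}_{\phi+\psi}(H_n(\phi,\psi))$ for $n\ge 1$. $\mathfrak{A}_\phi(\mathbf{x})\odot\mathfrak{A}_\psi(\mathbf{x})=(C_n)_{n\in\mathbb{N}}$ with $C_0=\mathbf{x}$ and $C_n=\sum_{l=0}^{n-1}\binom{n-1}{l}\mathfrak{D}_{\phi\cdot\psi}^{l}(\mathfrak{D}_\phi(\mathbf{x}))\cdot\mathfrak{D}_{\phi\cdot\psi}^{n-1-l}(\mathfrak{D}_\psi(\mathbf{x}))$ for $n\ge1$. *)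

theory Defs
  imports "HOL-Analysis.Finite_Cartesian_Product" "HOL-Algebra.Ring"
begin

text \<open>
  The index type \<open>'k\<close> stands for \<open>{1..k}\<close>, so that \<open>k = CARD('k) \<ge> 1\<close>, and a multi-index
  is an element of \<open>nat ^ 'k\<close>. A series is given by its coefficients with respect to the
  divided monomials \<open>x^n / n!\<close>; thus no division in the coefficient ring is needed.
\<close>

typedef ('a, 'k::finite) hseries = "UNIV :: (nat ^ 'k \<Rightarrow> 'a) set"
  morphisms hcoeff Hseries ..

lemma hcoeff_Hseries [simp]: "hcoeff (Hseries f) = f"
  by (simp add: Hseries_inverse)

lemma hseries_eq_iff: "f = g \<longleftrightarrow> (\<forall>n. hcoeff f n = hcoeff g n)"
  by (metis ext hcoeff_inverse)

definition multi_choose :: "nat ^ 'k::finite \<Rightarrow> nat ^ 'k \<Rightarrow> nat" where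
  "multi_choose n m = (\<Prod>i\<in>UNIV. (n $ i) choose (m $ i))"

lemma finite_multi_le [simp]: "finite {m. m \<le> (n :: nat ^ 'k::finite)}"
proof -
  have "{m. m \<le> n} \<subseteq> vec_lambda ` (PiE UNIV (\<lambda>i. {..n $ i}))"
  proof
    fix m assume "m \<in> {m. m \<le> n}"
    then have "vec_nth m \<in> PiE UNIV (\<lambda>i. {..n $ i})"
      by (auto simp: less_eq_vec_def)
    then have "vec_lambda (vec_nth m) \<in> vec_lambda ` (PiE UNIV (\<lambda>i. {..n $ i}))"
      by (rule imageI)
    then show "m \<in> vec_lambda ` (PiE UNIV (\<lambda>i. {..n $ i}))" by simp
  qed
  moreover have "finite (PiE (UNIV :: 'k set) (\<lambda>i. {..n $ i}))"
    by (rule finite_PiE) auto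
  ultimately show ?thesis by (meson finite_imageI finite_subset)
qed

lemma multi_diff_diff: "m \<le> n \<Longrightarrow> n - (n - m) = m" for m n :: "nat ^ 'k::finite"
  by (simp add: less_eq_vec_def vec_eq_iff)

lemma multi_diff_le: "n - m \<le> n" for m n :: "nat ^ 'k::finite"
  by (simp add: less_eq_vec_def)

lemma multi_choose_diff: "m \<le> n \<Longrightarrow> multi_choose n (n - m) = multi_choose n m"
  unfolding multi_choose_def less_eq_vec_def
  by (rule prod.cong) (auto simp flip: binomial_symmetric)

lemma multi_choose_mult:
  "l \<le> m \<Longrightarrow> m \<le> n \<Longrightarrow>
    multi_choose n m * multi_choose m l = multi_choose n l * multi_choose (n - l) (m - l)"
  unfolding multi_choose_def less_eq_vec_def prod.distrib [symmetric]
  by (rule prod.cong) (auto simp: choose_mult)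

text \<open>
  The product is the usual one, since
  \<open>x^m / m! * x^l / l! = multi_choose (m + l) m * x^(m + l) / (m + l)!\<close>.
\<close>

instantiation hseries :: (comm_ring_1, finite) comm_ring_1
begin

definition "0 = Hseries (\<lambda>_. 0)"
definition "1 = Hseries (\<lambda>n. if n = 0 then 1 else 0)"
definition "f + g = Hseries (\<lambda>n. hcoeff f n + hcoeff g n)"
definition "f - g = Hseries (\<lambda>n. hcoeff f n - hcoeff g n)"
definition "- f = Hseries (\<lambda>n. - hcoeff f n)"
definition "f * g = Hseries (\<lambda>n. \<Sum>m | m \<le> n.
  of_nat (multi_choose n m) * hcoeff f m * hcoeff g (n - m))"

instance
proof
  fix f g h :: "('a, 'b) hseries"
  show "f + g + h = f + (g + h)" "f + g = g + f" "0 + f = f" "- f + f = 0" "f - g = f + - g"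
    by (simp_all add: plus_hseries_def minus_hseries_def uminus_hseries_def zero_hseries_def
        hseries_eq_iff algebra_simps)
  show "(f + g) * h = f * h + g * h"
    by (simp add: plus_hseries_def times_hseries_def hseries_eq_iff algebra_simps sum.distrib)
  show "(0 :: ('a, 'b) hseries) \<noteq> 1"
    by (auto simp: zero_hseries_def one_hseries_def hseries_eq_iff)
  show "f * g = g * f"
    unfolding times_hseries_def hseries_eq_iff hcoeff_Hseries
  proof
    fix n :: "nat ^ 'b"
    show "(\<Sum>m | m \<le> n. of_nat (multi_choose n m) * hcoeff f m * hcoeff g (n - m)) =
      (\<Sum>m | m \<le> n. of_nat (multi_choose n m) * hcoeff g m * hcoeff f (n - m))"
      by (rule sum.reindex_bij_witness [of _ "\<lambda>m. n - m" "\<lambda>m. n - m"])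
        (auto simp: multi_choose_diff multi_diff_diff multi_diff_le algebra_simps)
  qed
  show "1 * f = f"
    unfolding times_hseries_def one_hseries_def hseries_eq_iff hcoeff_Hseries
  proof
    fix n :: "nat ^ 'b"
    have "(\<Sum>m | m \<le> n. of_nat (multi_choose n m) * (if m = 0 then 1 else 0) * hcoeff f (n - m)) =
      (\<Sum>m | m \<le> n. if m = 0 then hcoeff f n else 0)"
      by (rule sum.cong) (auto simp: multi_choose_def vec_eq_iff intro!: arg_cong [where f = "hcoeff f"])
    also have "\<dots> = hcoeff f n"
      by (subst sum.delta) (simp, simp add: less_eq_vec_def)
    finally show "(\<Sum>m | m \<le> n. of_nat (multi_choose n m) * (if m = 0 then 1 else 0)
      * hcoeff f (n - m)) = hcoeff f n" .
  qed
  show "f * g * h = f * (g * h)"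
    unfolding times_hseries_def hseries_eq_iff hcoeff_Hseries
  proof
    fix n :: "nat ^ 'b"
    let ?c = "\<lambda>n m. of_nat (multi_choose n m) :: 'a"
    have "(\<Sum>m | m \<le> n. ?c n m * (\<Sum>l | l \<le> m. ?c m l * hcoeff f l * hcoeff g (m - l)) *
        hcoeff h (n - m)) =
      (\<Sum>(m, l) \<in> Sigma {m. m \<le> n} (\<lambda>m. {l. l \<le> m}).
        ?c n m * ?c m l * hcoeff f l * hcoeff g (m - l) * hcoeff h (n - m))"
      by (simp add: sum.Sigma [symmetric] sum_distrib_left sum_distrib_right mult.assoc)
    also have "\<dots> = (\<Sum>(l, j) \<in> Sigma {l. l \<le> n} (\<lambda>l. {j. j \<le> n - l}).
        ?c n l * ?c (n - l) j * hcoeff f l * hcoeff g j * hcoeff h (n - l - j))"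
    proof (rule sum.reindex_bij_witness
        [of _ "\<lambda>(l, j). (l + j, l)" "\<lambda>(m, l). (l, m - l)"], goal_cases)
      case (1 p) then show ?case by (auto simp: less_eq_vec_def vec_eq_iff)
    next
      case (2 p) then show ?case
        by (auto simp: less_eq_vec_def) (meson diff_le_mono order_trans)+
    next
      case (3 p) then show ?case by (auto simp: less_eq_vec_def vec_eq_iff)
    next
      case (4 p) then show ?case
        by (auto simp: less_eq_vec_def)
          (metis Nat.le_diff_conv2 add.commute)
    next
      case (5 p)
      obtain m l where p: "p = (m, l)" by (cases p)
      with 5 have le: "l \<le> m" "m \<le> n" by auto
      then have "n - l - (m - l) = n - m" by (auto simp: less_eq_vec_def vec_eq_iff)
      moreover have "?c n m * ?c m l = ?c n l * ?c (n - l) (m - l)"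
        using multi_choose_mult [OF le] by (metis of_nat_mult)
      ultimately show ?case by (simp add: p)
    qed
    also have "\<dots> = (\<Sum>l | l \<le> n. ?c n l * hcoeff f l *
        (\<Sum>j | j \<le> n - l. ?c (n - l) j * hcoeff g j * hcoeff h (n - l - j)))"
      by (simp add: sum.Sigma [symmetric] sum_distrib_left sum_distrib_right algebra_simps)
    finally show "(\<Sum>m | m \<le> n. ?c n m * (\<Sum>l | l \<le> m. ?c m l * hcoeff f l * hcoeff g (m - l)) *
        hcoeff h (n - m)) = (\<Sum>l | l \<le> n. ?c n l * hcoeff f l *
        (\<Sum>j | j \<le> n - l. ?c (n - l) j * hcoeff g j * hcoeff h (n - l - j)))" .
  qed
qed

end

text \<open>In the basis of divided monomials, the partial derivative is an index shift.\<close>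

definition hderiv :: "'k::finite \<Rightarrow> ('a, 'k) hseries \<Rightarrow> ('a, 'k) hseries" where
  "hderiv l f = Hseries (\<lambda>n. hcoeff f (n + axis l 1))"

definition hvar :: "'k::finite \<Rightarrow> ('a::comm_ring_1, 'k) hseries" where
  "hvar l = Hseries (\<lambda>n. if n = axis l 1 then 1 else 0)"

text \<open>
  The product ring \<open>S\<close> is the vector type below; its library operations \<open>+\<close>, \<open>*\<close>, \<open>0\<close>, \<open>1\<close>
  are componentwise.
\<close>

type_synonym ('a, 'k) hvec = "('a, 'k) hseries ^ 'k"

definition hX :: "('a::comm_ring_1, 'k::finite) hvec" where
  "hX = (\<chi> l. hvar l)"

definition hD :: "('a::comm_ring_1, 'k::finite) hvec \<Rightarrow> ('a, 'k) hvec \<Rightarrow> ('a, 'k) hvec" where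
  "hD \<phi> F = (\<chi> i. \<Sum>l\<in>UNIV. hderiv l (F $ i) * \<phi> $ l)"

definition hA :: "('a::comm_ring_1, 'k::finite) hvec \<Rightarrow> ('a, 'k) hvec \<Rightarrow> nat \<Rightarrow> ('a, 'k) hvec" where
  "hA \<phi> F = (\<lambda>n. (hD \<phi> ^^ n) F)"

text \<open>The value at index \<open>0\<close> is a dummy.\<close>

fun hH :: "('a::comm_ring_1, 'k::finite) hvec \<Rightarrow> ('a, 'k) hvec \<Rightarrow> nat \<Rightarrow> ('a, 'k) hvec" where
  "hH \<phi> \<psi> 0 = 0"
| "hH \<phi> \<psi> (Suc 0) = 0"
| "hH \<phi> \<psi> (Suc (Suc n)) =
     hD \<phi> ((hD \<psi> ^^ Suc n) hX) + hD \<psi> ((hD \<phi> ^^ Suc n) hX) + hD (\<phi> + \<psi>) (hH \<phi> \<psi> (Suc n))"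

definition hB :: "('a::comm_ring_1, 'k::finite) hvec \<Rightarrow> ('a, 'k) hvec \<Rightarrow> nat \<Rightarrow> ('a, 'k) hvec" where
  "hB \<phi> \<psi> n =
    (if n = 0 then hX
     else if n = 1 then hD \<phi> hX + hD \<psi> hX
     else (hD \<phi> ^^ n) hX + (hD \<psi> ^^ n) hX + hH \<phi> \<psi> n)"

definition hC :: "('a::comm_ring_1, 'k::finite) hvec \<Rightarrow> ('a, 'k) hvec \<Rightarrow> nat \<Rightarrow> ('a, 'k) hvec" where
  "hC \<phi> \<psi> n =
    (if n = 0 then hX
     else (\<Sum>l = 0..n - 1. of_nat ((n - 1) choose l) *
       ((hD (\<phi> * \<psi>) ^^ l) (hD \<phi> hX) * (hD (\<phi> * \<psi>) ^^ (n - 1 - l)) (hD \<psi> hX))))"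

text \<open>
  The operations on sequences recover \<open>\<phi>\<close> from \<open>hA \<phi> hX\<close>. This is unambiguous, as the
  entry at index \<open>1\<close> is \<open>\<phi>\<close>; the lemmas after the definitions confirm the defining equations.
\<close>

definition hgen :: "(nat \<Rightarrow> ('a::comm_ring_1, 'k::finite) hvec) \<Rightarrow> ('a, 'k) hvec" where
  "hgen a = (THE \<phi>. hA \<phi> hX = a)"

definition boxplus ::
  "(nat \<Rightarrow> ('a::comm_ring_1, 'k::finite) hvec) \<Rightarrow> (nat \<Rightarrow> ('a, 'k) hvec) \<Rightarrow> nat \<Rightarrow> ('a, 'k) hvec"
  (infixl \<open>\<boxplus>\<close> 65) where
  "a \<boxplus> b = hB (hgen a) (hgen b)"

definition boxdot ::
  "(nat \<Rightarrow> ('a::comm_ring_1, 'k::finite) hvec) \<Rightarrow> (nat \<Rightarrow> ('a, 'k) hvec) \<Rightarrow> nat \<Rightarrow> ('a, 'k) hvec"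
  (infixl \<open>\<boxdot>\<close> 70) where
  "a \<boxdot> b = hC (hgen a) (hgen b)"

lemma hderiv_hvar:
  fixes l i :: "'k::finite"
  shows "hderiv l (hvar i) = (if l = i then 1 else (0 :: ('a::comm_ring_1, 'k) hseries))"
proof -
  have "n + axis l 1 = axis i 1 \<longleftrightarrow> l = i \<and> n = 0" for n :: "nat ^ 'k"
  proof
    assume eq: "n + axis l 1 = axis i 1"
    have "n $ l + 1 = (axis i 1 :: nat ^ 'k) $ l"
      using arg_cong [OF eq, of "\<lambda>v. v $ l"] by (simp add: axis_def)
    then have "l = i" by (auto simp: axis_def split: if_splits)
    with eq show "l = i \<and> n = 0" by simp
  qed auto
  then show ?thesis
    by (auto simp: hderiv_def hvar_def hseries_eq_iff one_hseries_def zero_hseries_def)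
qed

lemma hD_hX: "hD \<phi> hX = \<phi>"
  by (simp add: hD_def hX_def hderiv_hvar vec_eq_iff if_distrib if_distribR cong: if_cong)

lemma hgen_hA [simp]: "hgen (hA \<phi> hX) = \<phi>"
  unfolding hgen_def
proof (rule the_equality)
  fix \<psi> assume "hA \<psi> hX = hA \<phi> hX"
  then have "hA \<psi> hX 1 = hA \<phi> hX 1" by simp
  then show "\<psi> = \<phi>" by (simp add: hA_def hD_hX)
qed simp

lemma boxplus_hA: "hA \<phi> hX \<boxplus> hA \<psi> hX = hB \<phi> \<psi>"
  by (simp add: boxplus_def)

lemma boxdot_hA: "hA \<phi> hX \<boxdot> hA \<psi> hX = hC \<phi> \<psi>"
  by (simp add: boxdot_def)

end

theory Submission
  imports Defs
begin

text \<open>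
  Both operations on orbits are transported from \<open>S\<close>: the orbit of \<open>\<phi> + \<psi>\<close> is
  \<open>hB \<phi> \<psi>\<close> (\<open>hB_eq_hA\<close>) and the orbit of \<open>\<phi> * \<psi>\<close> is \<open>hC \<phi> \<psi>\<close> (\<open>hC_eq_hA\<close>). As the
  entry of \<open>hA \<phi> hX\<close> at index \<open>1\<close> is \<open>\<phi>\<close>, the map \<open>\<phi> \<mapsto> hA \<phi> hX\<close> is thus a bijection from
  \<open>S\<close> onto the orbits which carries \<open>+\<close> to \<open>\<boxplus>\<close> and \<open>*\<close> to \<open>\<boxdot>\<close>, and the ring axioms of
  \<open>S\<close> become those of the orbits.

  The first identity needs only that \<open>hD \<phi> F\<close> is additive in \<open>\<phi>\<close> and in \<open>F\<close>: expanding
  \<open>(hD \<phi> + hD \<psi>) ^^ n\<close>, the correction \<open>hH\<close> collects exactly the mixed terms. For the second,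
  \<open>hD (\<phi> * \<psi>)\<close> is a derivation of the product ring \<open>S\<close> and sends \<open>hX\<close> to \<open>\<phi> * \<psi>\<close>; hence its
  \<open>n\<close>-th iterate at \<open>hX\<close> is the \<open>(n - 1)\<close>-st iterate at the product \<open>\<phi> * \<psi>\<close>, which the
  general Leibniz rule expands into the binomial sum \<open>hC\<close>. The derivation property in turn rests
  on the product rule for the partial derivatives, which in the basis of divided monomials is
  Pascal's rule for multi-indices.
\<close>

section \<open>The product rule for partial derivatives\<close>

text \<open>
  Pascal's rule in the coordinate \<open>l\<close> alone; the other factors do not change.
\<close>

lemma multi_choose_add_axis:
  fixes n m :: "nat ^ 'k::finite"
  shows "multi_choose (n + axis l 1) m =
    multi_choose n m + (if m $ l = 0 then 0 else multi_choose n (m - axis l 1))"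
proof -
  have split: "multi_choose p q = (p $ l choose q $ l) * (\<Prod>i\<in>UNIV - {l}. p $ i choose q $ i)"
    for p q :: "nat ^ 'k"
    unfolding multi_choose_def by (rule prod.remove) auto
  let ?P = "\<Prod>i\<in>UNIV - {l}. n $ i choose m $ i"
  have "(\<Prod>i\<in>UNIV - {l}. (n + axis l 1) $ i choose m $ i) = ?P"
    "(\<Prod>i\<in>UNIV - {l}. n $ i choose (m - axis l 1) $ i) = ?P"
    by (rule prod.cong; simp add: axis_def)+
  then show ?thesis
    by (cases "m $ l") (simp_all add: split axis_def algebra_simps)
qed

lemma multi_choose_eq_0: "\<not> m \<le> n \<Longrightarrow> multi_choose n m = 0"
  by (auto simp: multi_choose_def less_eq_vec_def not_le)

lemma hderiv_add: "hderiv l (f + g) = hderiv l f + hderiv l g"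
  for f g :: "('a::comm_ring_1, 'k::finite) hseries"
  by (simp add: hderiv_def plus_hseries_def)

lemma hderiv_one: "hderiv l 1 = (0 :: ('a::comm_ring_1, 'k::finite) hseries)"
proof -
  have "n + axis l 1 \<noteq> 0" for n :: "nat ^ 'k"
    by (auto simp: vec_eq_iff axis_def)
  then show ?thesis
    by (simp add: hderiv_def one_hseries_def zero_hseries_def)
qed

text \<open>
  Pascal's rule splits each coefficient of \<open>hderiv l (f * g)\<close> into two sums; in the second,
  every index contains \<open>axis l 1\<close>, and removing it leaves a coefficient of \<open>hderiv l f * g\<close>.
\<close>

lemma hderiv_mult: "hderiv l (f * g) = hderiv l f * g + f * hderiv l g"
  for f g :: "('a::comm_ring_1, 'k::finite) hseries"
  unfolding hseries_eq_iff
proof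
  fix n :: "nat ^ 'k"
  let ?e = "axis l 1 :: nat ^ 'k"
  let ?c = "\<lambda>n m. of_nat (multi_choose n m) :: 'a"
  let ?M = "{m. m \<le> n + ?e}"
  let ?t = "\<lambda>m. hcoeff f m * hcoeff g (n + ?e - m)"
  have le: "m \<le> n + ?e" if "m \<le> n" for m
    using that by (auto simp: less_eq_vec_def intro: trans_le_add1)
  have "hcoeff (hderiv l (f * g)) n = (\<Sum>m\<in>?M. ?c (n + ?e) m * ?t m)"
    by (simp add: hderiv_def times_hseries_def mult.assoc)
  also have "\<dots> = (\<Sum>m\<in>?M. ?c n m * ?t m) +
      (\<Sum>m\<in>?M. if m $ l = 0 then 0 else ?c n (m - ?e) * ?t m)"
    unfolding sum.distrib [symmetric]
    by (rule sum.cong) (simp_all add: multi_choose_add_axis distrib_right del: One_nat_def)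
  also have "(\<Sum>m\<in>?M. ?c n m * ?t m) = (\<Sum>m | m \<le> n. ?c n m * ?t m)"
    by (rule sum.mono_neutral_right) (auto simp: le multi_choose_eq_0 simp del: One_nat_def)
  also have "\<dots> = (\<Sum>m | m \<le> n. ?c n m * hcoeff f m * hcoeff g (n - m + ?e))"
  proof (rule sum.cong)
    fix m assume "m \<in> {m. m \<le> n}"
    then have "n + ?e - m = n - m + ?e"
      by (auto simp: less_eq_vec_def vec_eq_iff)
    then show "?c n m * ?t m = ?c n m * hcoeff f m * hcoeff g (n - m + ?e)"
      by (simp add: mult.assoc)
  qed simp
  also have "\<dots> = hcoeff (f * hderiv l g) n"
    by (simp add: hderiv_def times_hseries_def)
  also have "(\<Sum>m\<in>?M. if m $ l = 0 then 0 else ?c n (m - ?e) * ?t m) =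
      (\<Sum>m | m \<le> n + ?e \<and> m $ l \<noteq> 0. ?c n (m - ?e) * ?t m)"
    by (rule sum.mono_neutral_cong_right) auto
  also have "\<dots> = (\<Sum>m | m \<le> n. ?c n m * hcoeff f (m + ?e) * hcoeff g (n - m))"
  proof (rule sum.reindex_bij_witness [of _ "\<lambda>m. m + ?e" "\<lambda>m. m - ?e"], goal_cases)
    case (1 m)
    then show ?case by (auto simp: vec_eq_iff axis_def)
  next
    case (2 m)
    then show ?case by (auto simp: less_eq_vec_def le_diff_conv)
  next
    case (3 m)
    then show ?case by (simp add: vec_eq_iff)
  next
    case (4 m)
    then show ?case by (simp add: less_eq_vec_def axis_def)
  next
    case (5 m)
    then have "m - ?e + ?e = m" "n + ?e - m = n - (m - ?e)"
      by (auto simp: vec_eq_iff axis_def)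
    then show ?case by (simp add: mult.assoc)
  qed
  also have "\<dots> = hcoeff (hderiv l f * g) n"
    by (simp add: hderiv_def times_hseries_def)
  finally show "hcoeff (hderiv l (f * g)) n = hcoeff (hderiv l f * g + f * hderiv l g) n"
    by (simp add: plus_hseries_def add.commute)
qed

section \<open>Bilinearity and derivation property of \<open>hD\<close>\<close>

lemma hD_add: "hD \<phi> (F + G) = hD \<phi> F + hD \<phi> G"
  by (simp add: hD_def vec_eq_iff hderiv_add distrib_right sum.distrib)

lemma hD_add_left: "hD (\<phi> + \<psi>) F = hD \<phi> F + hD \<psi> F"
  by (simp add: hD_def vec_eq_iff distrib_left sum.distrib)

lemma hD_mult: "hD \<phi> (F * G) = hD \<phi> F * G + F * hD \<phi> G"
  by (simp add: hD_def vec_eq_iff hderiv_mult sum.distrib [symmetric] sum_distrib_left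
      sum_distrib_right algebra_simps)

lemma hD_one: "hD \<phi> 1 = 0"
  by (simp add: hD_def vec_eq_iff hderiv_one)

lemma hD_zero: "hD \<phi> 0 = 0"
  using hD_add [of \<phi> 0 0] by simp

lemma hD_zero_left: "hD 0 F = 0"
  by (simp add: hD_def vec_eq_iff)

section \<open>The general Leibniz rule\<close>

text \<open>
  As for the binomial theorem: \<open>d\<close> acts on a product as the sum of two operators, one for each
  factor, which commute.
\<close>

lemma derivation_funpow_mult:
  fixes d :: "'r::comm_ring_1 \<Rightarrow> 'r"
  assumes add: "\<And>x y. d (x + y) = d x + d y"
    and mult: "\<And>x y. d (x * y) = d x * y + x * d y"
  shows "(d ^^ n) (x * y) = (\<Sum>l\<le>n. of_nat (n choose l) * ((d ^^ l) x * (d ^^ (n - l)) y))"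
proof (induction n)
  case 0
  show ?case by simp
next
  case (Suc n)
  have zero: "d 0 = 0"
    using add [of 0 0] by simp
  have d_of_nat: "d (of_nat m * z) = of_nat m * d z" for m z
    by (induction m) (simp_all add: zero add distrib_right)
  have d_sum: "d (sum f A) = (\<Sum>a\<in>A. d (f a))" for f :: "nat \<Rightarrow> 'r" and A
    by (induction A rule: infinite_finite_induct) (simp_all add: zero add)
  let ?t = "\<lambda>i j. (d ^^ i) x * (d ^^ j) y"
  have "(d ^^ Suc n) (x * y) = (\<Sum>l\<le>n. of_nat (n choose l) * ?t (Suc l) (n - l)) +
      (\<Sum>l\<le>n. of_nat (n choose l) * ?t l (Suc (n - l)))"
    by (simp add: Suc.IH d_sum d_of_nat mult [of "(d ^^ _) x"] distrib_left sum.distrib)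
  \<comment> \<open>the new summand at \<open>Suc n\<close> vanishes; it aligns the range with that of the first sum\<close>
  also have "(\<Sum>l\<le>n. of_nat (n choose l) * ?t l (Suc (n - l))) =
      (\<Sum>l\<le>Suc n. of_nat (n choose l) * ?t l (Suc n - l))"
    by (simp add: Suc_diff_le binomial_eq_0)
  also have "\<dots> = ?t 0 (Suc n) + (\<Sum>l\<le>n. of_nat (n choose Suc l) * ?t (Suc l) (n - l))"
    by (subst sum.atMost_Suc_shift) simp
  finally have "(d ^^ Suc n) (x * y) =
      ?t 0 (Suc n) + (\<Sum>l\<le>n. of_nat (Suc n choose Suc l) * ?t (Suc l) (n - l))"
    by (simp add: distrib_right sum.distrib algebra_simps)
  also have "\<dots> = (\<Sum>l\<le>Suc n. of_nat (Suc n choose l) * ?t l (Suc n - l))"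
    by (subst sum.atMost_Suc_shift) simp
  finally show ?case .
qed

section \<open>Orbits of sums and products\<close>

text \<open>
  Writing \<open>hD (\<phi> + \<psi>) = hD \<phi> + hD \<psi>\<close>, one more step applied to the \<open>n\<close>-th iterate yields the
  two pure iterates of order \<open>n + 1\<close>; everything else is what the recursion for \<open>hH\<close> adds.
\<close>

lemma hB_eq_hA: "hB \<phi> \<psi> = hA (\<phi> + \<psi>) hX"
proof
  have step: "(hD (\<phi> + \<psi>) ^^ Suc n) hX =
      (hD \<phi> ^^ Suc n) hX + (hD \<psi> ^^ Suc n) hX + hH \<phi> \<psi> (Suc n)" for n
  proof (induction n)
    case 0
    show ?case by (simp add: hD_hX)
  next
    case (Suc n)
    then show ?case
      by (simp add: hD_add hD_add_left algebra_simps)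
  qed
  fix n
  show "hB \<phi> \<psi> n = hA (\<phi> + \<psi>) hX n"
  proof (cases n)
    case 0
    then show ?thesis by (simp add: hA_def hB_def)
  next
    case (Suc m)
    then show ?thesis
      using step [of m] by (cases m) (simp_all add: hA_def hB_def)
  qed
qed

text \<open>
  The first step turns \<open>hX\<close> into \<open>\<phi> * \<psi>\<close>, and the Leibniz rule expands the other
  \<open>n - 1\<close> steps; this is why the binomial coefficients in \<open>hC\<close> have upper index \<open>n - 1\<close>.
\<close>

lemma hC_eq_hA: "hC \<phi> \<psi> = hA (\<phi> * \<psi>) hX"
proof
  fix n
  show "hC \<phi> \<psi> n = hA (\<phi> * \<psi>) hX n"
  proof (cases n)
    case 0
    then show ?thesis by (simp add: hA_def hC_def)
  next
    case (Suc m)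
    have "hA (\<phi> * \<psi>) hX n = (hD (\<phi> * \<psi>) ^^ m) (\<phi> * \<psi>)"
      by (simp add: hA_def Suc funpow_Suc_right hD_hX del: funpow.simps)
    also have "\<dots> = hC \<phi> \<psi> n"
      by (simp add: derivation_funpow_mult hD_add hD_mult hC_def Suc hD_hX atMost_atLeast0)
    finally show ?thesis by simp
  qed
qed

lemma hA_zero: "hA 0 hX = (\<lambda>n. if n = 0 then hX else 0)"
proof
  show "hA 0 hX n = (if n = 0 then hX else 0)" for n
    by (cases n) (simp_all add: hA_def hD_zero_left)
qed

lemma hA_one: "hA 1 hX = (\<lambda>n. if n = 0 then hX else if n = 1 then 1 else 0)"
proof
  have "(hD 1 ^^ m) (hD 1 1) = 0" for m
    by (induction m) (simp_all add: hD_one hD_zero)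
  then have "hA 1 hX (Suc (Suc m)) = 0" for m
    by (simp add: hA_def funpow_Suc_right hD_hX del: funpow.simps)
  moreover have "hA 1 hX 0 = hX" "hA 1 hX (Suc 0) = 1"
    by (simp_all add: hA_def hD_hX)
  ultimately show "hA 1 hX n = (if n = 0 then hX else if n = 1 then 1 else 0)" for n
    by (cases n; cases "n - 1") simp_all
qed

theorem theorem4:
  shows "cring
    \<lparr>carrier = range (\<lambda>\<phi> :: ('a::{idom, ring_char_0}, 'k::finite) hvec. hA \<phi> hX),
     mult = (\<boxdot>),
     one = (\<lambda>n. if n = 0 then hX else if n = 1 then 1 else 0),
     zero = (\<lambda>n. if n = 0 then hX else 0),
     add = (\<boxplus>)\<rparr>"
  unfolding hA_zero [symmetric] hA_one [symmetric]
proof (rule cringI)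
  let ?R = "\<lparr>carrier = range (\<lambda>\<phi> :: ('a, 'k) hvec. hA \<phi> hX), mult = (\<boxdot>), one = hA 1 hX,
     zero = hA 0 hX, add = (\<boxplus>)\<rparr>"
  show "abelian_group ?R"
  proof (rule abelian_groupI)
    fix a assume "a \<in> carrier ?R"
    then obtain \<phi> where a: "a = hA \<phi> hX" by auto
    have "hA (- \<phi>) hX \<boxplus> hA \<phi> hX = hA 0 hX"
      by (simp add: boxplus_hA boxdot_hA hB_eq_hA hC_eq_hA)
    then show "\<exists>b\<in>carrier ?R. b \<oplus>\<^bsub>?R\<^esub> a = \<zero>\<^bsub>?R\<^esub>"
      by (auto simp: a)
  qed (auto simp: boxplus_hA boxdot_hA hB_eq_hA hC_eq_hA algebra_simps)
  show "comm_monoid ?R"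
    by (rule comm_monoidI) (auto simp: boxplus_hA boxdot_hA hB_eq_hA hC_eq_hA algebra_simps)
qed (auto simp: boxplus_hA boxdot_hA hB_eq_hA hC_eq_hA algebra_simps)

end
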